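(* Let $1<m<2$ be a real number and let $G$ be an admissible kernel. For each $L>0$ there exist $\nu>0$ and $\rho\in\mathcal D$ such that $$\nu\,\rho(x)^{m-1}=\mathcal G_L[\rho](x)\qquad\text{for all }x\in[0,L].$$
   Context: A kernel $G:\mathbb R\to\mathbb R$ is called admissible if: (1) $G\ge 0$ and $\mathrm{supp}(G)=\mathbb R$; (2) $G\in W^{1,1}(\mathbb R)\cap C^2(\mathbb R\setminus\{0\})$ (in particular $G$ is taken to be continuous and bounded on $\mathbb R$); (3) $G(x)=g(|x|)$ for all $x\in\mathbb R$; (4) $g'(r)<0$ for all $r>0$ and $\lim_{r\to+\infty}g(r)=0$. For $L>0$ and $\rho\in C([0,L])$ define $$\mathcal G_L[\rho](x)=\int_0^L\big[G(x-y)+G(x+y)-G(L-y)-G(L+y)\big]\rho(y)\,dy,\qquad x\in[0,L].$$ Define $$\mathcal D=\{\rho\in C([0,L]) : \rho \text{ nonnegative and nonincreasing},\ \rho(0)=1,\ \rho(L)=0\}.$$ *)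

theory Defs
  imports "HOL-Analysis.Analysis"
begin

definition supp :: "(real \<Rightarrow> real) \<Rightarrow> real set" where
  "supp f = closure {x. f x \<noteq> 0}"

definition test_function :: "(real \<Rightarrow> real) \<Rightarrow> bool" where
  "test_function \<phi> \<longleftrightarrow>
     (\<forall>k x. ((deriv ^^ k) \<phi>) differentiable (at x)) \<and> compact (supp \<phi>)"

definition weak_derivative :: "(real \<Rightarrow> real) \<Rightarrow> (real \<Rightarrow> real) \<Rightarrow> bool" where
  "weak_derivative f h \<longleftrightarrow>
     (\<forall>\<phi>. test_function \<phi> \<longrightarrow>
        (LINT x|lborel. f x * deriv \<phi> x) = - (LINT x|lborel. h x * \<phi> x))"

text \<open>The Sobolev space of integrable functions on the line with an integrable weak derivative,
  as a set of functions rather than of almost-everywhere classes.\<close>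

definition W11 :: "(real \<Rightarrow> real) set" where
  "W11 = {f. integrable lborel f \<and> (\<exists>h. integrable lborel h \<and> weak_derivative f h)}"

text \<open>Only used for open \<open>S\<close>, so the derivatives are two-sided.\<close>

definition C2_on :: "real set \<Rightarrow> (real \<Rightarrow> real) \<Rightarrow> bool" where
  "C2_on S f \<longleftrightarrow>
     (\<exists>f' f''. (\<forall>x\<in>S. (f has_real_derivative f' x) (at x)) \<and>
               (\<forall>x\<in>S. (f' has_real_derivative f'' x) (at x)) \<and>
               continuous_on S f'')"

text \<open>Continuity on the whole line selects the continuous representative of the Sobolev class of
  \<open>G\<close>; boundedness then follows from membership in \<open>W11\<close> and is listed only for convenience.
  The profile \<open>g\<close> is determined by \<open>G\<close> on the half-line \<open>r \<ge> 0\<close>, and its values at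
  negative arguments are irrelevant.\<close>

definition admissible_kernel :: "(real \<Rightarrow> real) \<Rightarrow> bool" where
  "admissible_kernel G \<longleftrightarrow>
     (\<forall>x. G x \<ge> 0) \<and> supp G = UNIV \<and>
     G \<in> W11 \<and> C2_on (- {0}) G \<and> continuous_on UNIV G \<and> bounded (range G) \<and>
     (\<exists>g. (\<forall>x. G x = g \<bar>x\<bar>) \<and>
          (\<forall>r>0. \<exists>d<0. (g has_real_derivative d) (at r)) \<and>
          (g \<longlongrightarrow> 0) at_top)"

definition kernel_op :: "(real \<Rightarrow> real) \<Rightarrow> real \<Rightarrow> (real \<Rightarrow> real) \<Rightarrow> real \<Rightarrow> real" where
  "kernel_op G L \<rho> x =
     integral {0..L} (\<lambda>y. (G (x - y) + G (x + y) - G (L - y) - G (L + y)) * \<rho> y)"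

text \<open>Elements of \<open>C([0,L])\<close> are represented by total functions of which only the values on
  \<open>{0..L}\<close> matter.\<close>

definition profiles :: "real \<Rightarrow> (real \<Rightarrow> real) set" where
  "profiles L = {\<rho>. continuous_on {0..L} \<rho> \<and> (\<forall>x\<in>{0..L}. \<rho> x \<ge> 0) \<and>
                    antimono_on {0..L} \<rho> \<and> \<rho> 0 = 1 \<and> \<rho> L = 0}"

end

theory Submission
  imports Defs "HOL-Complex_Analysis.Great_Picard"
begin

text \<open>With \<open>w = \<rho> powr (m - 1)\<close> and \<open>p = 1 / (m - 1)\<close> the equation says that \<open>w\<close> is fixed by
  \<open>w \<mapsto> \<G>[w powr p] / \<G>[w powr p] 0\<close>. Since \<open>\<integral>\<^sub>0\<^sup>a (G (x - y) + G (x + y)) dy\<close> strictly decreases in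
  \<open>x \<ge> 0\<close>, the second mean value theorem shows that \<open>\<G>[\<rho>]\<close> is nonincreasing for nonincreasing
  \<open>\<rho>\<close>, and, crucially, that \<open>\<G>[\<rho>] 0 \<ge> c \<integral>\<rho>\<close> with \<open>c > 0\<close> independent of \<open>\<rho>\<close>. Hence the normalized
  images are equicontinuous even though \<open>\<integral>\<rho>\<close> may be arbitrarily small. Kuhn's lemma, which unlike
  Brouwer's theorem for Euclidean types has the dimension as a variable, gives approximate fixed
  points among step functions, and the Arzela-Ascoli theorem lets the mesh tend to zero.\<close>

section \<open>Approximate fixed points on a cube\<close>

text \<open>Kuhn's lemma on a fine grid yields a cell in which, for every coordinate
  \<open>i\<close>, one vertex has \<open>F\<close> weakly raising that coordinate and another has
  \<open>F\<close> weakly lowering it. Uniform continuity carries both inequalities to the lowest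
  corner of the cell.\<close>

lemma cube_approx_fixed_point:
  fixes F :: "(nat \<Rightarrow> real) \<Rightarrow> nat \<Rightarrow> real" and n :: nat
  defines "C \<equiv> {u. \<forall>i<n. u i \<in> {0..1}}"
  assumes F: "\<And>u i. u \<in> C \<Longrightarrow> i < n \<Longrightarrow> F u i \<in> {0..1}"
    and cont: "\<And>e. e > 0 \<Longrightarrow> \<exists>d>0. \<forall>u\<in>C. \<forall>v\<in>C. (\<forall>i<n. \<bar>u i - v i\<bar> \<le> d) \<longrightarrow>
                 (\<forall>i<n. \<bar>F u i - F v i\<bar> \<le> e)"
    and "e > 0"
  obtains u where "u \<in> C" "\<And>i. i < n \<Longrightarrow> \<bar>F u i - u i\<bar> \<le> e"
proof -
  obtain d where "d > 0" and d: "\<And>u v i. u \<in> C \<Longrightarrow> v \<in> C \<Longrightarrow> (\<And>i. i < n \<Longrightarrow> \<bar>u i - v i\<bar> \<le> d) \<Longrightarrow> i < n \<Longrightarrow>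
                 \<bar>F u i - F v i\<bar> \<le> e / 2"
    using cont[of "e / 2"] \<open>e > 0\<close> by (metis half_gt_zero)
  obtain p :: nat where p: "1 / min d (e / 2) < real p"
    using reals_Archimedean2 by blast
  have "min d (e / 2) > 0" using \<open>d > 0\<close> \<open>e > 0\<close> by auto
  then have "real p > 0" using p by (smt (verit) divide_pos_pos)
  then have "p > 0" by simp
  \<comment> \<open>The bound by \<open>d\<close> controls the change of \<open>F\<close> within a
    cell, the bound by \<open>e / 2\<close> that of a coordinate.\<close>
  have mesh: "1 / real p \<le> min d (e / 2)"
    using p \<open>real p > 0\<close> \<open>min d (e / 2) > 0\<close>
    by (simp add: divide_less_eq divide_le_eq mult.commute del: min_less_iff_conj min.bounded_iff)
  define grid where "grid x = (\<lambda>i. real (x i) / real p)" for x :: "nat \<Rightarrow> nat"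
  \<comment> \<open>Kuhn's lemma prescribes the labels on the faces. As \<open>F\<close> has values
    in \<open>{0..1}\<close>, label 0 still implies \<open>grid x i \<le> F (grid x) i\<close>
    there, and label 1 the reverse inequality.\<close>
  define label where "label x i = (if x i = 0 then 0 else if x i = p then 1
      else if grid x i \<le> F (grid x) i then 0 else (1::nat))" for x i
  have grid_C: "grid x \<in> C" if "\<forall>i<n. x i \<le> p" for x
    using that \<open>p > 0\<close> by (auto simp: grid_def C_def)
  obtain q where q: "\<forall>i<n. q i < p"
    and rs: "\<forall>i<n. \<exists>r s. (\<forall>j<n. q j \<le> r j \<and> r j \<le> q j + 1) \<and>
               (\<forall>j<n. q j \<le> s j \<and> s j \<le> q j + 1) \<and> label r i \<noteq> label s i"
    by (rule kuhn_lemma[OF \<open>p > 0\<close>, of n label]) (use \<open>p > 0\<close> in \<open>auto simp: label_def\<close>)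
  have q_C: "grid q \<in> C" using q by (intro grid_C) (simp add: less_imp_le)
  have near: "grid r \<in> C" "\<bar>F (grid q) i - F (grid r) i\<bar> \<le> e / 2" "grid q i \<le> grid r i"
    "grid r i \<le> grid q i + e / 2"
    if r: "\<forall>j<n. q j \<le> r j \<and> r j \<le> q j + 1" and "i < n" for r i
  proof -
    have "r j \<le> p" if "j < n" for j
    proof -
      have "r j \<le> q j + 1" "q j < p" using r q that by auto
      then show ?thesis by linarith
    qed
    then show C: "grid r \<in> C" by (intro grid_C) auto
    have step: "grid q j \<le> grid r j \<and> grid r j \<le> grid q j + 1 / real p" if "j < n" for j
    proof -
      have "q j \<le> r j" "r j \<le> q j + 1" using r that by auto
      then have "real (q j) \<le> real (r j)" "real (r j) \<le> real (q j) + 1" by linarith+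
      then show ?thesis
        unfolding grid_def using \<open>real p > 0\<close> by (simp add: divide_right_mono flip: add_divide_distrib)
    qed
    show "\<bar>F (grid q) i - F (grid r) i\<bar> \<le> e / 2"
    proof (rule d[OF q_C C _ \<open>i < n\<close>])
      fix j assume "j < n"
      then show "\<bar>grid q j - grid r j\<bar> \<le> d" using step[of j] mesh by auto
    qed
    show "grid q i \<le> grid r i" "grid r i \<le> grid q i + e / 2" using step[OF \<open>i < n\<close>] mesh by auto
  qed
  have "\<bar>F (grid q) i - grid q i\<bar> \<le> e" if i: "i < n" for i
  proof -
    obtain r s where r: "\<forall>j<n. q j \<le> r j \<and> r j \<le> q j + 1"
      and s: "\<forall>j<n. q j \<le> s j \<and> s j \<le> q j + 1" and "label r i = 0" "label s i \<noteq> 0"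
    proof -
      obtain r s where *: "\<forall>j<n. q j \<le> r j \<and> r j \<le> q j + 1"
        "\<forall>j<n. q j \<le> s j \<and> s j \<le> q j + 1" "label r i \<noteq> label s i"
        using rs[rule_format, OF i] by blast
      then have "label r i = 0 \<and> label s i \<noteq> 0 \<or> label s i = 0 \<and> label r i \<noteq> 0"
        by (auto simp: label_def split: if_splits)
      then show thesis using * that by blast
    qed
    note nr = near[OF r i] and ns = near[OF s i]
    have "grid r i \<le> F (grid r) i"
      using \<open>label r i = 0\<close> F[OF nr(1) i] by (auto simp: label_def grid_def split: if_splits)
    moreover have "F (grid s) i \<le> grid s i"
      using \<open>label s i \<noteq> 0\<close> F[OF ns(1) i] \<open>p > 0\<close> by (auto simp: label_def grid_def split: if_splits)
    \<comment> \<open>Through \<open>s\<close>: \<open>F (grid q) i \<le> F (grid s) i + e / 2 \<le>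
      grid s i + e / 2 \<le> grid q i + e\<close>. The other bound, through \<open>r\<close>, loses
      only \<open>e / 2\<close>.\<close>
    ultimately show ?thesis using nr ns by linarith
  qed
  then show thesis using that q_C by blast
qed

section \<open>The kernel operator on nonincreasing profiles\<close>

lemma antimono_mult_integrable:
  fixes f \<rho> :: "real \<Rightarrow> real"
  assumes "f integrable_on {a..b}" "a \<le> b" "antimono_on {a..b} \<rho>"
  shows "(\<lambda>y. f y * \<rho> y) integrable_on {a..b}"
proof -
  obtain c where "((\<lambda>x. - \<rho> x * f x) has_integral - \<rho> a * integral {a..c} f + - \<rho> b * integral {c..b} f) {a..b}"
    by (rule second_mean_value_theorem_full[OF assms(1,2), where g = "\<lambda>x. - \<rho> x"])
       (use assms(3) in \<open>auto simp: monotone_on_def\<close>)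
  then have "(\<lambda>x. - (- \<rho> x * f x)) integrable_on {a..b}"
    by (intro integrable_neg has_integral_integrable)
  then show ?thesis by (simp add: mult.commute)
qed

text \<open>By the second mean value theorem, testing against the indicators of the intervals \<open>{a..t}\<close>
  suffices.\<close>

lemma antimono_mult_integral_nonneg:
  fixes f \<rho> :: "real \<Rightarrow> real"
  assumes f: "f integrable_on {a..b}" and "a \<le> b" and \<rho>: "antimono_on {a..b} \<rho>" and "\<rho> b \<ge> 0"
    and pos: "\<And>t. t \<in> {a..b} \<Longrightarrow> integral {a..t} f \<ge> 0"
  shows "integral {a..b} (\<lambda>y. f y * \<rho> y) \<ge> 0"
proof -
  obtain c where c: "c \<in> {a..b}"
    and eq: "integral {a..b} (\<lambda>x. - \<rho> x * f x) = - \<rho> a * integral {a..c} f + - \<rho> b * integral {c..b} f"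
    by (rule second_mean_value_theorem[OF f \<open>a \<le> b\<close>, where g = "\<lambda>x. - \<rho> x"])
       (use \<rho> in \<open>auto simp: monotone_on_def\<close>)
  have split: "integral {a..c} f + integral {c..b} f = integral {a..b} f"
    using c f by (intro Henstock_Kurzweil_Integration.integral_combine) auto
  have "integral {a..b} (\<lambda>y. f y * \<rho> y) = - integral {a..b} (\<lambda>x. - \<rho> x * f x)"
    unfolding integral_neg[symmetric] by (intro integral_cong) simp
  \<comment> \<open>Regrouping as in summation by parts leaves only integrals starting at
    \<open>a\<close>, with the nonnegative weights \<open>\<rho> a - \<rho> b\<close> and
    \<open>\<rho> b\<close>.\<close>
  also have "\<dots> = (\<rho> a - \<rho> b) * integral {a..c} f + \<rho> b * integral {a..b} f"
    unfolding eq split[symmetric] by (simp add: algebra_simps)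
  also have "\<dots> \<ge> 0"
    using monotone_onD[OF \<rho>, of a b] \<open>a \<le> b\<close> \<open>\<rho> b \<ge> 0\<close> pos[of c] pos[of b] c by simp
  finally show ?thesis .
qed

section \<open>Monotonicity and lower bounds for an even, strictly decreasing kernel\<close>

locale decreasing_kernel =
  fixes G :: "real \<Rightarrow> real" and L B :: real
  assumes L_pos: "L > 0"
    and cont_G: "continuous_on UNIV G"
    and even: "G (- x) = G x"
    and decreasing: "0 \<le> r \<Longrightarrow> r < s \<Longrightarrow> G s < G r"
    and bound: "\<bar>G x\<bar> \<le> B"
begin

lemma decreasing_abs: "\<bar>x\<bar> < \<bar>y\<bar> \<Longrightarrow> G y < G x"
  using decreasing[of "\<bar>x\<bar>" "\<bar>y\<bar>"] even[of x] even[of y] by (auto simp: abs_if split: if_splits)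

lemma cont_G_comp [continuous_intros]:
  "continuous_on S f \<Longrightarrow> continuous_on S (\<lambda>x. G (f x))"
  by (rule continuous_on_compose2[OF cont_G]) auto

text \<open>The integral is that of \<open>G\<close> over \<open>{x - a..x + a}\<close>. Its
  derivative in \<open>x\<close> is \<open>G (x + a) - G (x - a)\<close>, which is negative for
  \<open>x > 0\<close> because \<open>x - a\<close> is closer to the origin than
  \<open>x + a\<close>.\<close>

lemma folded_integral_decreasing:
  assumes "0 < a" "0 \<le> x" "x < x'"
  shows "integral {0..a} (\<lambda>y. G (x' - y) + G (x' + y)) < integral {0..a} (\<lambda>y. G (x - y) + G (x + y))"
proof -
  have "\<exists>F. \<forall>x::real. - \<infinity> < ereal x \<longrightarrow> ereal x < \<infinity> \<longrightarrow> (F has_vector_derivative G x) (at x)"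
    by (rule einterval_antiderivative) (use cont_G in \<open>auto simp: continuous_on_eq_continuous_at\<close>)
  then obtain \<Gamma> where \<Gamma>: "\<And>x. (\<Gamma> has_real_derivative G x) (at x)"
    by (auto simp: has_real_derivative_iff_has_vector_derivative)
  have \<Gamma>_comp: "((\<lambda>x. \<Gamma> (h x)) has_real_derivative G (h x) * h') (at x)"
    if "(h has_real_derivative h') (at x)" for h h' x
    using DERIV_chain2[OF \<Gamma> that] .
  have int: "integral {0..a} (\<lambda>y. G (x - y) + G (x + y)) = \<Gamma> (x + a) - \<Gamma> (x - a)" for x
  proof -
    have "((\<lambda>y. G (x - y) + G (x + y)) has_integral
        (\<Gamma> (x + a) - \<Gamma> (x - a)) - (\<Gamma> (x + 0) - \<Gamma> (x - 0))) {0..a}"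
    proof (rule fundamental_theorem_of_calculus)
      fix y
      have "((\<lambda>y. \<Gamma> (x + y) - \<Gamma> (x - y)) has_real_derivative G (x + y) * 1 - G (x - y) * (- 1)) (at y)"
        by (intro DERIV_diff \<Gamma>_comp) (auto intro!: derivative_eq_intros)
      then show "((\<lambda>y. \<Gamma> (x + y) - \<Gamma> (x - y)) has_vector_derivative G (x - y) + G (x + y)) (at y within {0..a})"
        by (simp add: has_real_derivative_iff_has_vector_derivative has_vector_derivative_at_within add.commute)
    qed (use assms in auto)
    then show ?thesis by (simp add: integral_unique)
  qed
  have der: "((\<lambda>x. \<Gamma> (x + a) - \<Gamma> (x - a)) has_real_derivative G (t + a) * 1 - G (t - a) * 1) (at t)" for t
    by (intro DERIV_diff \<Gamma>_comp) (auto intro!: derivative_eq_intros)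
  have "\<Gamma> (x' + a) - \<Gamma> (x' - a) < \<Gamma> (x + a) - \<Gamma> (x - a)"
  \<comment> \<open>For \<open>x = 0\<close> the derivative vanishes at the left endpoint by
    evenness, so its strict sign is required only in the open interval.\<close>
  proof (rule DERIV_neg_imp_decreasing_open[OF \<open>x < x'\<close>])
    fix t assume "x < t"
    then have "G (t + a) < G (t - a)" using assms by (intro decreasing_abs) auto
    then show "\<exists>y. ((\<lambda>x. \<Gamma> (x + a) - \<Gamma> (x - a)) has_real_derivative y) (at t) \<and> y < 0"
      using der[of t] by (intro exI conjI) auto
  next
    show "continuous_on {x..x'} (\<lambda>x. \<Gamma> (x + a) - \<Gamma> (x - a))"
      using der DERIV_isCont by (intro continuous_at_imp_continuous_on) blast
  qed
  then show ?thesis unfolding int .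
qed

lemma kernel_op_integrable:
  fixes f \<rho> :: "real \<Rightarrow> real"
  assumes "antimono_on {0..L} \<rho>" "continuous_on UNIV f"
  shows "(\<lambda>y. f y * \<rho> y) integrable_on {0..L}"
proof (rule antimono_mult_integrable)
  show "f integrable_on {0..L}"
    using assms(2) by (auto intro: integrable_continuous_real continuous_on_subset)
qed (use assms(1) L_pos in auto)

lemma kernel_op_diff:
  assumes "antimono_on {0..L} \<rho>"
  shows "kernel_op G L \<rho> x - kernel_op G L \<rho> x' =
    integral {0..L} (\<lambda>y. (G (x - y) + G (x + y) - (G (x' - y) + G (x' + y))) * \<rho> y)"
proof -
  have int: "(\<lambda>y. (G (z - y) + G (z + y) - G (L - y) - G (L + y)) * \<rho> y) integrable_on {0..L}" for z
    by (intro kernel_op_integrable assms continuous_intros)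
  show ?thesis
    unfolding kernel_op_def integral_diff[OF int int, symmetric]
    by (intro integral_cong) (simp add: algebra_simps)
qed

text \<open>The difference of the kernels at \<open>x\<close> and \<open>x'\<close> may change sign
  in \<open>y\<close>, but its integrals over \<open>{0..t}\<close> are nonnegative by
  \<open>folded_integral_decreasing\<close>, and that suffices against a nonincreasing
  weight.\<close>

lemma kernel_op_antimono:
  assumes \<rho>: "antimono_on {0..L} \<rho>" "\<rho> L \<ge> 0" and x: "0 \<le> x" "x \<le> x'"
  shows "kernel_op G L \<rho> x' \<le> kernel_op G L \<rho> x"
proof -
  have "integral {0..L} (\<lambda>y. (G (x - y) + G (x + y) - (G (x' - y) + G (x' + y))) * \<rho> y) \<ge> 0"
  proof (intro antimono_mult_integral_nonneg)
    fix t assume t: "t \<in> {0..L}"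
    have "integral {0..t} (\<lambda>y. G (x - y) + G (x + y) - (G (x' - y) + G (x' + y))) =
      integral {0..t} (\<lambda>y. G (x - y) + G (x + y)) - integral {0..t} (\<lambda>y. G (x' - y) + G (x' + y))"
      by (intro integral_diff integrable_continuous_real continuous_intros)
    also have "\<dots> \<ge> 0"
      using folded_integral_decreasing[of t x x'] x t by (cases "t = 0"; cases "x = x'") auto
    finally show "integral {0..t} (\<lambda>y. G (x - y) + G (x + y) - (G (x' - y) + G (x' + y))) \<ge> 0" .
  qed (use \<rho> L_pos in \<open>auto intro!: integrable_continuous_real continuous_intros\<close>)
  then show ?thesis using kernel_op_diff[OF \<rho>(1), of x x'] by simp
qed

lemma kernel_op_right: "kernel_op G L \<rho> L = 0"
  by (simp add: kernel_op_def)

lemma kernel_op_nonneg: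
  assumes "antimono_on {0..L} \<rho>" "\<rho> L \<ge> 0" "x \<in> {0..L}"
  shows "kernel_op G L \<rho> x \<ge> 0"
  using kernel_op_antimono[OF assms(1,2), of x L] assms(3) by (simp add: kernel_op_right)

text \<open>Positivity of the integrals is not enough, since they tend to 0 with \<open>t\<close>; a
  bound linear in \<open>t\<close> is what comparison with a constant kernel requires. Small and
  large \<open>t\<close> need different arguments.\<close>

lemma kernel_zero_integral_lower_bound:
  obtains c where "c > 0" "\<And>t. t \<in> {0..L} \<Longrightarrow> c * t \<le> integral {0..t} (\<lambda>y. G (0 - y) + G (0 + y) - G (L - y) - G (L + y))"
proof -
  let ?k = "\<lambda>y. G (0 - y) + G (0 + y) - G (L - y) - G (L + y)"
  let ?W = "\<lambda>t. integral {0..t} ?k"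
  have k_cont: "continuous_on S ?k" for S by (intro continuous_intros)
  \<comment> \<open>For \<open>y \<le> L / 2\<close> the part \<open>G y - G (L - y)\<close> of the
    kernel is nonnegative, and the rest, \<open>G y - G (L + y)\<close>, has a positive
    minimum.\<close>
  have "continuous_on {0..L/2} (\<lambda>y. G y - G (L + y))" by (intro continuous_intros)
  then obtain y1 where y1: "y1 \<in> {0..L/2}" "\<And>y. y \<in> {0..L/2} \<Longrightarrow> G y1 - G (L + y1) \<le> G y - G (L + y)"
    using continuous_attains_inf[of "{0..L/2}" "\<lambda>y. G y - G (L + y)"] L_pos by auto
  define c1 where "c1 = G y1 - G (L + y1)"
  have "c1 > 0" unfolding c1_def using decreasing[of y1 "L + y1"] y1(1) L_pos by auto
  have near0: "c1 * t \<le> ?W t" if "t \<in> {0..L/2}" for t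
  proof -
    have "integral {0..t} (\<lambda>y. c1) \<le> ?W t"
    proof (intro integral_le integrable_continuous_real k_cont continuous_intros)
      fix y assume y: "y \<in> {0..t}"
      have "G (L - y) \<le> G y"
        using decreasing[of y "L - y"] y that by (cases "y = L - y") auto
      then show "c1 \<le> ?k y" using y1(2)[of y] y that even[of y] by (auto simp: c1_def)
    qed
    then show ?thesis using that by (simp add: mult.commute)
  qed
  have "continuous_on {0..L} ?W"
    by (intro indefinite_integral_continuous_1 integrable_continuous_real k_cont)
  then have "continuous_on {L/2..L} ?W" by (rule continuous_on_subset) (use L_pos in auto)
  then obtain t2 where t2: "t2 \<in> {L/2..L}" "\<And>t. t \<in> {L/2..L} \<Longrightarrow> ?W t2 \<le> ?W t"
    using continuous_attains_inf[of "{L/2..L}" ?W] L_pos by auto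
  define c2 where "c2 = ?W t2"
  \<comment> \<open>Beyond \<open>L / 2\<close> the kernel itself may be negative; positivity of its
    integral comes from comparing the folded integrals at 0 and at \<open>L\<close>.\<close>
  have "?W t2 = integral {0..t2} (\<lambda>y. G (0 - y) + G (0 + y)) - integral {0..t2} (\<lambda>y. G (L - y) + G (L + y))"
    by (subst integral_diff[symmetric]) (auto intro!: integrable_continuous_real continuous_intros integral_cong)
  then have "c2 > 0"
    using folded_integral_decreasing[of t2 0 L] t2(1) L_pos by (simp add: c2_def)
  have far: "c2 / L * t \<le> ?W t" if "t \<in> {L/2..L}" for t
  proof -
    have "c2 / L * t \<le> c2 / L * L" using that \<open>c2 > 0\<close> L_pos by (intro mult_left_mono) auto
    also have "\<dots> \<le> ?W t" using t2(2)[OF that] L_pos by (simp add: c2_def)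
    finally show ?thesis .
  qed
  show thesis
  proof
    show "min c1 (c2 / L) > 0" using \<open>c1 > 0\<close> \<open>c2 > 0\<close> L_pos by simp
    fix t assume t: "t \<in> {0..L}"
    show "min c1 (c2 / L) * t \<le> ?W t"
    proof (cases "t \<le> L / 2")
      case True
      then show ?thesis using near0[of t] t mult_right_mono[of "min c1 (c2 / L)" c1 t] by simp
    next
      case False
      then show ?thesis using far[of t] t mult_right_mono[of "min c1 (c2 / L)" "c2 / L" t] by simp
    qed
  qed
qed

text \<open>The kernel minus \<open>c\<close> has nonnegative integrals over all
  \<open>{0..t}\<close>, so the second mean value criterion applies to it. The constant is thus
  common to all profiles.\<close>

lemma kernel_op_zero_lower_bound:
  obtains c where "c > 0" "\<And>\<rho>. antimono_on {0..L} \<rho> \<Longrightarrow> \<rho> L \<ge> 0 \<Longrightarrow> c * integral {0..L} \<rho> \<le> kernel_op G L \<rho> 0"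
proof -
  let ?k = "\<lambda>y. G (0 - y) + G (0 + y) - G (L - y) - G (L + y)"
  obtain c where "c > 0" and c: "\<And>t. t \<in> {0..L} \<Longrightarrow> c * t \<le> integral {0..t} ?k"
    using kernel_zero_integral_lower_bound by blast
  have "c * integral {0..L} \<rho> \<le> kernel_op G L \<rho> 0" if \<rho>: "antimono_on {0..L} \<rho>" "\<rho> L \<ge> 0" for \<rho>
  proof -
    have "integral {0..L} (\<lambda>y. (?k y - c) * \<rho> y) \<ge> 0"
    proof (intro antimono_mult_integral_nonneg \<rho>)
      fix t assume t: "t \<in> {0..L}"
      have "integral {0..t} (\<lambda>y. ?k y - c) = integral {0..t} ?k - integral {0..t} (\<lambda>y. c)"
        by (intro integral_diff integrable_continuous_real continuous_intros)
      then show "integral {0..t} (\<lambda>y. ?k y - c) \<ge> 0" using c[OF t] t by (simp add: mult.commute)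
    qed (use L_pos in \<open>auto intro!: integrable_continuous_real continuous_intros\<close>)
    also have "integral {0..L} (\<lambda>y. (?k y - c) * \<rho> y) =
        integral {0..L} (\<lambda>y. ?k y * \<rho> y) - integral {0..L} (\<lambda>y. c * \<rho> y)"
      unfolding left_diff_distrib[where b = c]
      by (intro integral_diff kernel_op_integrable \<rho> continuous_intros)
    finally show ?thesis by (simp add: kernel_op_def)
  qed
  then show thesis using that \<open>c > 0\<close> by blast
qed

text \<open>Monotonicity gives \<open>\<rho> \<ge> \<rho> h\<close> on \<open>{0..h}\<close>, so one
  value bounds the mass from below. This keeps the denominators of the normalization away from
  0.\<close>

lemma kernel_op_zero_pos:
  obtains c where "c > 0" "\<And>\<rho> h. antimono_on {0..L} \<rho> \<Longrightarrow> \<rho> L \<ge> 0 \<Longrightarrow> h \<in> {0..L} \<Longrightarrow>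
    c * (h * \<rho> h) \<le> kernel_op G L \<rho> 0"
proof -
  obtain c where "c > 0" and c: "\<And>\<rho>. antimono_on {0..L} \<rho> \<Longrightarrow> \<rho> L \<ge> 0 \<Longrightarrow> c * integral {0..L} \<rho> \<le> kernel_op G L \<rho> 0"
    using kernel_op_zero_lower_bound by blast
  have "c * (h * \<rho> h) \<le> kernel_op G L \<rho> 0" if \<rho>: "antimono_on {0..L} \<rho>" "\<rho> L \<ge> 0" and h: "h \<in> {0..L}" for \<rho> h
  proof -
    have int: "\<rho> integrable_on {0..L}" using kernel_op_integrable[OF \<rho>(1), of "\<lambda>_. 1"] by simp
    have anti: "\<rho> y \<le> \<rho> x" if "0 \<le> x" "x \<le> y" "y \<le> L" for x y
      using monotone_onD[OF \<rho>(1), of x y] that by auto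
    have inth: "\<rho> integrable_on {0..h}" using int h by (auto intro: integrable_subinterval_real)
    have "h * \<rho> h = integral {0..h} (\<lambda>y. \<rho> h)" using h by simp
    also have "\<dots> \<le> integral {0..h} \<rho>"
      by (intro integral_le inth) (use h anti in auto)
    also have "\<dots> \<le> integral {0..L} \<rho>"
    proof (rule integral_subset_le[OF _ inth int])
      show "\<forall>y\<in>{0..L}. 0 \<le> \<rho> y" using anti \<rho>(2) by force
    qed (use h in auto)
    finally have "c * (h * \<rho> h) \<le> c * integral {0..L} \<rho>" using \<open>c > 0\<close> by (intro mult_left_mono) auto
    then show ?thesis using c[OF \<rho>] by simp
  qed
  then show thesis using that \<open>c > 0\<close> by blast
qed

text \<open>The oscillation is at most a small multiple of the mass of \<rho>, and the mass is
  controlled by the value at 0. Being relative to that value, the bound survives division by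
  it.\<close>

lemma kernel_op_equicontinuous:
  assumes "e > 0"
  obtains d where "d > 0" "\<And>\<rho> x x'. antimono_on {0..L} \<rho> \<Longrightarrow> \<rho> L \<ge> 0 \<Longrightarrow> x \<in> {0..L} \<Longrightarrow> x' \<in> {0..L} \<Longrightarrow>
    \<bar>x - x'\<bar> < d \<Longrightarrow> \<bar>kernel_op G L \<rho> x - kernel_op G L \<rho> x'\<bar> \<le> e * kernel_op G L \<rho> 0"
proof -
  obtain c where "c > 0" and c: "\<And>\<rho>. antimono_on {0..L} \<rho> \<Longrightarrow> \<rho> L \<ge> 0 \<Longrightarrow> c * integral {0..L} \<rho> \<le> kernel_op G L \<rho> 0"
    using kernel_op_zero_lower_bound by blast
  \<comment> \<open>The 2 accounts for the two kernel terms that depend on \<open>x\<close>;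
    \<open>c\<close> converts mass into the value at 0.\<close>
  define \<eta> where "\<eta> = e * c / 2"
  have "\<eta> > 0" using assms \<open>c > 0\<close> by (simp add: \<eta>_def)
  have "uniformly_continuous_on {- L..2 * L} G"
    by (intro compact_uniformly_continuous continuous_on_subset[OF cont_G]) auto
  then obtain d where "d > 0" and d: "\<And>s t. s \<in> {- L..2 * L} \<Longrightarrow> t \<in> {- L..2 * L} \<Longrightarrow> \<bar>s - t\<bar> < d \<Longrightarrow> \<bar>G s - G t\<bar> < \<eta>"
    unfolding uniformly_continuous_on_def dist_real_def using \<open>\<eta> > 0\<close> by metis
  have "\<bar>kernel_op G L \<rho> x - kernel_op G L \<rho> x'\<bar> \<le> e * kernel_op G L \<rho> 0"
    if \<rho>: "antimono_on {0..L} \<rho>" "\<rho> L \<ge> 0" and x: "x \<in> {0..L}" "x' \<in> {0..L}" "\<bar>x - x'\<bar> < d" for \<rho> x x'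
  proof -
    have "\<bar>kernel_op G L \<rho> x - kernel_op G L \<rho> x'\<bar> \<le> integral {0..L} (\<lambda>y. 2 * \<eta> * \<rho> y)"
      unfolding kernel_op_diff[OF \<rho>(1)] real_norm_def[symmetric]
    proof (intro integral_norm_bound_integral kernel_op_integrable \<rho> continuous_intros)
      fix y assume y: "y \<in> {0..L}"
      have "\<bar>G (x - y) - G (x' - y)\<bar> < \<eta>" "\<bar>G (x + y) - G (x' + y)\<bar> < \<eta>"
        using x y by (auto intro!: d)
      then have "\<bar>G (x - y) + G (x + y) - (G (x' - y) + G (x' + y))\<bar> \<le> 2 * \<eta>" by linarith
      moreover have "\<rho> y \<ge> 0" using monotone_onD[OF \<rho>(1), of y L] \<rho>(2) y by auto
      ultimately show "norm ((G (x - y) + G (x + y) - (G (x' - y) + G (x' + y))) * \<rho> y) \<le> 2 * \<eta> * \<rho> y"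
        by (simp add: abs_mult mult_right_mono)
    qed
    also have "\<dots> = e * (c * integral {0..L} \<rho>)" by (simp add: \<eta>_def)
    also have "\<dots> \<le> e * kernel_op G L \<rho> 0" using c[OF \<rho>] assms by (intro mult_left_mono) auto
    finally show ?thesis .
  qed
  then show thesis using that \<open>d > 0\<close> by blast
qed

lemma kernel_op_lipschitz:
  assumes "antimono_on {0..L} \<rho>" "antimono_on {0..L} \<sigma>" "\<And>y. y \<in> {0..L} \<Longrightarrow> \<bar>\<rho> y - \<sigma> y\<bar> \<le> e"
  shows "\<bar>kernel_op G L \<rho> x - kernel_op G L \<sigma> x\<bar> \<le> 4 * B * L * e"
proof -
  let ?k = "\<lambda>y. G (x - y) + G (x + y) - G (L - y) - G (L + y)"
  have int: "(\<lambda>y. ?k y * \<rho> y) integrable_on {0..L}" "(\<lambda>y. ?k y * \<sigma> y) integrable_on {0..L}"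
    by (intro kernel_op_integrable assms continuous_intros)+
  have "\<bar>kernel_op G L \<rho> x - kernel_op G L \<sigma> x\<bar> \<le> integral {0..L} (\<lambda>y. 4 * B * e)"
    unfolding kernel_op_def integral_diff[OF int, symmetric] real_norm_def[symmetric]
  proof (intro integral_norm_bound_integral integrable_diff int)
    fix y assume y: "y \<in> {0..L}"
    have "\<bar>?k y\<bar> \<le> 4 * B" using bound[of "x - y"] bound[of "x + y"] bound[of "L - y"] bound[of "L + y"] by linarith
    then have "\<bar>?k y\<bar> * \<bar>\<rho> y - \<sigma> y\<bar> \<le> 4 * B * e" using assms(3)[OF y] by (intro mult_mono) auto
    then show "norm (?k y * \<rho> y - ?k y * \<sigma> y) \<le> 4 * B * e"
      by (simp add: abs_mult flip: right_diff_distrib)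
  qed auto
  also have "\<dots> = 4 * B * L * e" using L_pos by (simp add: mult_ac)
  finally show ?thesis .
qed

section \<open>The normalized operator\<close>

text \<open>Continuity and endpoint values are left out so that step functions belong to the set;
  the limit profile recovers both.\<close>

definition unit_profiles :: "(real \<Rightarrow> real) set" where
  "unit_profiles = {w. antimono_on {0..L} w \<and> w ` {0..L} \<subseteq> {0..1}}"

definition power_op :: "real \<Rightarrow> (real \<Rightarrow> real) \<Rightarrow> real \<Rightarrow> real" where
  "power_op p w = kernel_op G L (\<lambda>y. w y powr p)"

text \<open>If the value at 0 vanishes, division by zero makes this the zero function. Range,
  monotonicity and equicontinuity hold in that case too; stability needs a positive
  denominator.\<close>

definition normalized_op :: "real \<Rightarrow> (real \<Rightarrow> real) \<Rightarrow> real \<Rightarrow> real" where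
  "normalized_op p w x = power_op p w x / power_op p w 0"

lemma unit_profilesD:
  assumes "w \<in> unit_profiles"
  shows "antimono_on {0..L} w" "x \<in> {0..L} \<Longrightarrow> 0 \<le> w x" "x \<in> {0..L} \<Longrightarrow> w x \<le> 1"
  using assms by (auto simp: unit_profiles_def image_subset_iff)

lemma powr_antimono_on:
  assumes "w \<in> unit_profiles" "p \<ge> 0"
  shows "antimono_on {0..L} (\<lambda>y. w y powr p)"
  using assms unit_profilesD[OF assms(1)]
  by (auto simp: monotone_on_def intro!: powr_mono2)

lemma power_op_antimono:
  assumes "w \<in> unit_profiles" "p \<ge> 0" "0 \<le> x" "x \<le> x'"
  shows "power_op p w x' \<le> power_op p w x"
  unfolding power_op_def using assms by (intro kernel_op_antimono powr_antimono_on) auto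

lemma power_op_nonneg:
  assumes "w \<in> unit_profiles" "p \<ge> 0" "x \<in> {0..L}"
  shows "power_op p w x \<ge> 0"
  unfolding power_op_def using assms by (intro kernel_op_nonneg powr_antimono_on) auto

lemma power_op_zero_pos:
  assumes "p \<ge> 0"
  obtains c where "c > 0" "\<And>w h. w \<in> unit_profiles \<Longrightarrow> h \<in> {0..L} \<Longrightarrow> c * (h * w h powr p) \<le> power_op p w 0"
proof -
  obtain c where "c > 0" and c: "\<And>\<rho> h. antimono_on {0..L} \<rho> \<Longrightarrow> \<rho> L \<ge> 0 \<Longrightarrow> h \<in> {0..L} \<Longrightarrow>
    c * (h * \<rho> h) \<le> kernel_op G L \<rho> 0"
    using kernel_op_zero_pos by blast
  show thesis
  proof (rule that[OF \<open>c > 0\<close>])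
    fix w h assume "w \<in> unit_profiles" "h \<in> {0..L}"
    then show "c * (h * w h powr p) \<le> power_op p w 0"
      unfolding power_op_def using assms by (intro c powr_antimono_on) auto
  qed
qed

lemma power_op_stable:
  assumes "p > 0" "e > 0"
  obtains d where "d > 0" "\<And>w v x. w \<in> unit_profiles \<Longrightarrow> v \<in> unit_profiles \<Longrightarrow>
    (\<And>y. y \<in> {0..L} \<Longrightarrow> \<bar>w y - v y\<bar> < d) \<Longrightarrow> \<bar>power_op p w x - power_op p v x\<bar> \<le> e"
proof -
  have "B \<ge> 0" using bound[of 0] by simp
  \<comment> \<open>The summand 1 makes the denominator positive from \<open>B \<ge> 0\<close>
    alone.\<close>
  define \<eta> where "\<eta> = e / (4 * B * L + 1)"
  have "4 * B * L \<ge> 0" using \<open>B \<ge> 0\<close> L_pos by simp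
  then have "\<eta> > 0" "4 * B * L * \<eta> \<le> e"
    using \<open>e > 0\<close> by (auto simp: \<eta>_def field_simps)
  have "uniformly_continuous_on {0..1} (\<lambda>a::real. a powr p)"
    using \<open>p > 0\<close> by (intro compact_uniformly_continuous continuous_on_powr') (auto intro!: continuous_intros)
  then obtain d where "d > 0" and d: "\<And>a b::real. a \<in> {0..1} \<Longrightarrow> b \<in> {0..1} \<Longrightarrow> \<bar>a - b\<bar> < d \<Longrightarrow>
      \<bar>a powr p - b powr p\<bar> < \<eta>"
    unfolding uniformly_continuous_on_def dist_real_def using \<open>\<eta> > 0\<close> by metis
  show thesis
  proof (rule that[OF \<open>d > 0\<close>])
    fix w v x assume w: "w \<in> unit_profiles" and v: "v \<in> unit_profiles"
      and wv: "\<And>y. y \<in> {0..L} \<Longrightarrow> \<bar>w y - v y\<bar> < d"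
    have "\<bar>power_op p w x - power_op p v x\<bar> \<le> 4 * B * L * \<eta>"
      unfolding power_op_def
    proof (intro kernel_op_lipschitz powr_antimono_on w v)
      fix y assume "y \<in> {0..L}"
      then show "\<bar>w y powr p - v y powr p\<bar> \<le> \<eta>"
        using unit_profilesD[OF w] unit_profilesD[OF v] wv by (intro less_imp_le d) auto
    qed (use \<open>p > 0\<close> in auto)
    then show "\<bar>power_op p w x - power_op p v x\<bar> \<le> e" using \<open>4 * B * L * \<eta> \<le> e\<close> by linarith
  qed
qed

lemma normalized_op_range:
  assumes "w \<in> unit_profiles" "p \<ge> 0" "x \<in> {0..L}"
  shows "normalized_op p w x \<in> {0..1}"
  using power_op_antimono[OF assms(1,2), of 0 x] power_op_nonneg[OF assms] assms(3)
  by (auto simp: normalized_op_def divide_le_eq_1)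

lemma normalized_op_antimono:
  assumes "w \<in> unit_profiles" "p \<ge> 0" "0 \<le> x" "x \<le> x'"
  shows "normalized_op p w x' \<le> normalized_op p w x"
  using power_op_antimono[OF assms] power_op_nonneg[OF assms(1,2), of 0] L_pos
  by (auto simp: normalized_op_def intro!: divide_right_mono)

lemma normalized_op_equicontinuous:
  assumes "p \<ge> 0" "e > 0"
  obtains d where "d > 0" "\<And>w x x'. w \<in> unit_profiles \<Longrightarrow> x \<in> {0..L} \<Longrightarrow> x' \<in> {0..L} \<Longrightarrow>
    \<bar>x - x'\<bar> < d \<Longrightarrow> \<bar>normalized_op p w x - normalized_op p w x'\<bar> \<le> e"
proof -
  obtain d where "d > 0" and d: "\<And>\<rho> x x'. antimono_on {0..L} \<rho> \<Longrightarrow> \<rho> L \<ge> 0 \<Longrightarrow> x \<in> {0..L} \<Longrightarrow> x' \<in> {0..L} \<Longrightarrow>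
    \<bar>x - x'\<bar> < d \<Longrightarrow> \<bar>kernel_op G L \<rho> x - kernel_op G L \<rho> x'\<bar> \<le> e * kernel_op G L \<rho> 0"
    using kernel_op_equicontinuous[OF \<open>e > 0\<close>] by blast
  show thesis
  proof (rule that[OF \<open>d > 0\<close>])
    fix w x x' assume w: "w \<in> unit_profiles" and x: "x \<in> {0..L}" "x' \<in> {0..L}" "\<bar>x - x'\<bar> < d"
    have "\<bar>power_op p w x - power_op p w x'\<bar> \<le> e * power_op p w 0"
      unfolding power_op_def using x w assms(1) by (intro d powr_antimono_on) auto
    moreover have "power_op p w 0 \<ge> 0" using w assms(1) L_pos by (intro power_op_nonneg) auto
    ultimately show "\<bar>normalized_op p w x - normalized_op p w x'\<bar> \<le> e"
      using \<open>e > 0\<close> by (cases "power_op p w 0 = 0")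
        (auto simp: normalized_op_def divide_le_eq simp flip: diff_divide_distrib)
  qed
qed

text \<open>The common value 1 at \<open>h\<close> keeps both denominators above
  \<open>c * h\<close>, which makes the quotient uniformly continuous in the profile.\<close>

lemma normalized_op_stable:
  assumes "p > 0" "e > 0" "h \<in> {0<..L}"
  obtains d where "d > 0" "\<And>w v x. w \<in> unit_profiles \<Longrightarrow> v \<in> unit_profiles \<Longrightarrow> w h = 1 \<Longrightarrow> v h = 1 \<Longrightarrow>
    (\<And>y. y \<in> {0..L} \<Longrightarrow> \<bar>w y - v y\<bar> < d) \<Longrightarrow> x \<in> {0..L} \<Longrightarrow>
    \<bar>normalized_op p w x - normalized_op p v x\<bar> \<le> e"
proof -
  obtain c where "c > 0" and c: "\<And>w h. w \<in> unit_profiles \<Longrightarrow> h \<in> {0..L} \<Longrightarrow> c * (h * w h powr p) \<le> power_op p w 0"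
    using power_op_zero_pos[of p] \<open>p > 0\<close> by (auto simp: less_imp_le)
  define \<delta> where "\<delta> = e * (c * h) / 2"
  have "c * h > 0" using \<open>c > 0\<close> assms(3) by simp
  then have "\<delta> > 0" using \<open>e > 0\<close> by (simp add: \<delta>_def)
  obtain d where "d > 0" and d: "\<And>w v x. w \<in> unit_profiles \<Longrightarrow> v \<in> unit_profiles \<Longrightarrow>
    (\<And>y. y \<in> {0..L} \<Longrightarrow> \<bar>w y - v y\<bar> < d) \<Longrightarrow> \<bar>power_op p w x - power_op p v x\<bar> \<le> \<delta>"
    using power_op_stable[OF \<open>p > 0\<close> \<open>\<delta> > 0\<close>] by blast
  show thesis
  proof (rule that[OF \<open>d > 0\<close>])
    fix w v x assume w: "w \<in> unit_profiles" "w h = 1" and v: "v \<in> unit_profiles" "v h = 1"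
      and wv: "\<And>y. y \<in> {0..L} \<Longrightarrow> \<bar>w y - v y\<bar> < d" and x: "x \<in> {0..L}"
    let ?a = "power_op p w" and ?b = "power_op p v"
    have pos: "c * h \<le> ?a 0" "c * h \<le> ?b 0"
      using c[OF w(1), of h] c[OF v(1), of h] w(2) v(2) assms(3) by auto
    have diff: "\<bar>?a x - ?b x\<bar> \<le> \<delta>" "\<bar>?b 0 - ?a 0\<bar> \<le> \<delta>"
      using d[OF w(1) v(1) wv, of x] d[OF w(1) v(1) wv, of 0] by linarith+
    have q: "normalized_op p v x \<in> {0..1}" using v(1) \<open>p > 0\<close> x by (intro normalized_op_range) auto
    \<comment> \<open>The change of denominator is multiplied by a quotient in
      \<open>{0..1}\<close>, so each of the two errors is at most \<open>\<delta>\<close>.\<close>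
    have "normalized_op p w x - normalized_op p v x = ((?a x - ?b x) + normalized_op p v x * (?b 0 - ?a 0)) / ?a 0"
      using pos \<open>c * h > 0\<close> by (simp add: normalized_op_def field_simps)
    then have "\<bar>normalized_op p w x - normalized_op p v x\<bar> =
        \<bar>(?a x - ?b x) + normalized_op p v x * (?b 0 - ?a 0)\<bar> / ?a 0"
      using pos \<open>c * h > 0\<close> by (simp add: abs_divide)
    also have "\<dots> \<le> (2 * \<delta>) / (c * h)"
    proof (rule frac_le)
      have "\<bar>normalized_op p v x * (?b 0 - ?a 0)\<bar> \<le> 1 * \<delta>"
        unfolding abs_mult using q diff by (intro mult_mono) auto
      then show "\<bar>(?a x - ?b x) + normalized_op p v x * (?b 0 - ?a 0)\<bar> \<le> 2 * \<delta>" using diff by linarith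
    qed (use pos \<open>c * h > 0\<close> \<open>\<delta> > 0\<close> in auto)
    also have "\<dots> = e" using \<open>c > 0\<close> assms(3) by (simp add: \<delta>_def)
    finally show "\<bar>normalized_op p w x - normalized_op p v x\<bar> \<le> e" .
  qed
qed

section \<open>Approximate fixed points\<close>

text \<open>Taking running minima retracts the cube onto the nonincreasing step functions.\<close>

definition step_profile :: "nat \<Rightarrow> (nat \<Rightarrow> real) \<Rightarrow> real \<Rightarrow> real" where
  "step_profile n u x = Min (insert 1 (u ` {i \<in> {1..<n}. real i * L / real n \<le> x}))"

lemma step_profile_cases:
  obtains "step_profile n u x = 1"
  | i where "i \<in> {1..<n}" "real i * L / real n \<le> x" "step_profile n u x = u i"
proof -
  have "step_profile n u x \<in> insert 1 (u ` {i \<in> {1..<n}. real i * L / real n \<le> x})"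
    unfolding step_profile_def by (rule Min_in) auto
  then show thesis using that by auto
qed

lemma step_profile_le:
  shows "step_profile n u x \<le> 1"
    and "i \<in> {1..<n} \<Longrightarrow> real i * L / real n \<le> x \<Longrightarrow> step_profile n u x \<le> u i"
  unfolding step_profile_def by (auto intro!: Min_le)

lemma step_profile_unit:
  assumes "\<forall>i<n. u i \<in> {0..1}"
  shows "step_profile n u \<in> unit_profiles"
proof -
  have "step_profile n u y \<le> step_profile n u x" if "x \<le> y" for x y
  proof (cases rule: step_profile_cases[of n u x])
    case 1
    then show ?thesis using step_profile_le(1) by simp
  next
    case (2 i)
    then show ?thesis using step_profile_le(2)[of i n y u] that by simp
  qed
  moreover have "step_profile n u x \<in> {0..1}" for x
    using assms step_profile_le(1)[of n u x] by (cases rule: step_profile_cases[of n u x]) auto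
  ultimately show ?thesis by (auto simp: unit_profiles_def monotone_on_def)
qed

text \<open>Index 0 is left out of the minimum, so only the inserted 1 remains before the first
  positive node. This supplies the common value 1 required by
  \<open>normalized_op_stable\<close>.\<close>

lemma step_profile_first_cell:
  assumes "x < L / real n"
  shows "step_profile n u x = 1"
proof (cases rule: step_profile_cases[of n u x])
  case (2 i)
  then have "1 * (L / real n) \<le> real i * (L / real n)"
    using L_pos by (intro mult_right_mono) auto
  then show ?thesis using 2 assms by simp
qed

text \<open>Minima are nonexpansive in the sup distance, so the map on the cube inherits the
  stability of the normalized operator.\<close>

lemma step_profile_diff:
  assumes "\<forall>i<n. \<bar>u i - v i\<bar> \<le> d" "d \<ge> 0"
  shows "\<bar>step_profile n u x - step_profile n v x\<bar> \<le> d"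
proof -
  have le: "step_profile n u x \<le> step_profile n v x + d" if "\<forall>i<n. \<bar>u i - v i\<bar> \<le> d" for u v
  proof (cases rule: step_profile_cases[of n v x])
    case 1
    then show ?thesis using step_profile_le(1)[of n u x] assms(2) by simp
  next
    case (2 i)
    then have "step_profile n u x \<le> u i" "\<bar>u i - v i\<bar> \<le> d"
      using step_profile_le(2)[of i n x u] that by auto
    then show ?thesis using 2 by simp
  qed
  show ?thesis using le[OF assms(1)] le[of v u] assms(1) by (simp add: abs_minus_commute abs_diff_le_iff)
qed

text \<open>The cube map samples the normalized image at the nodes. An approximate fixed point
  \<open>u\<close> need not be monotone, but it is close to the samples of a nonincreasing function,
  so passing to running minima does no harm. Equicontinuity fills in the points between
  nodes.\<close>

lemma approximate_fixed_profile:
  assumes "p > 0" "e > 0"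
  obtains w where "w \<in> unit_profiles" "power_op p w 0 > 0"
    "\<And>x. x \<in> {0..L} \<Longrightarrow> \<bar>normalized_op p w x - w x\<bar> \<le> e"
proof -
  have "p \<ge> 0" "e / 2 > 0" using assms by auto
  obtain d where "d > 0" and d: "\<And>w x x'. w \<in> unit_profiles \<Longrightarrow> x \<in> {0..L} \<Longrightarrow> x' \<in> {0..L} \<Longrightarrow>
    \<bar>x - x'\<bar> < d \<Longrightarrow> \<bar>normalized_op p w x - normalized_op p w x'\<bar> \<le> e / 2"
    using normalized_op_equicontinuous[OF \<open>p \<ge> 0\<close> \<open>e / 2 > 0\<close>] by blast
  obtain n :: nat where n: "L / d < real n" using reals_Archimedean2 by blast
  have "real n > 0" using n \<open>d > 0\<close> L_pos by (smt (verit) divide_pos_pos)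
  then have mesh: "L / real n < d" using n \<open>d > 0\<close> by (simp add: field_simps)
  \<comment> \<open>The midpoint of the first cell, where every step profile equals 1.\<close>
  define h where "h = L / real n / 2"
  have "L / real n \<le> L / 1" using \<open>real n > 0\<close> L_pos by (intro divide_left_mono) auto
  then have h: "h \<in> {0<..L}" "h < L / real n"
    using half_gt_zero[of "L / real n"] L_pos \<open>real n > 0\<close> by (simp_all add: h_def field_simps)
  let ?w = "step_profile n"
  have h1: "?w u h = 1" for u using step_profile_first_cell h(2) .
  define node where "node i = real i * L / real n" for i
  have node: "node i \<in> {0..L}" if "i < n" for i
    using that L_pos by (auto simp: node_def divide_le_eq)
  define F where "F u i = normalized_op p (?w u) (node i)" for u i
  obtain u :: "nat \<Rightarrow> real" where u: "\<forall>i<n. u i \<in> {0..1}" and fix_u: "\<And>i. i < n \<Longrightarrow> \<bar>F u i - u i\<bar> \<le> e / 2"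
  proof (rule cube_approx_fixed_point[of n F "e / 2"])
    fix u :: "nat \<Rightarrow> real" and i assume "u \<in> {u. \<forall>i<n. u i \<in> {0..1}}" "i < n"
    then show "F u i \<in> {0..1}"
      unfolding F_def using \<open>p \<ge> 0\<close> by (intro normalized_op_range step_profile_unit node) auto
  next
    fix \<epsilon> :: real assume "\<epsilon> > 0"
    obtain \<delta> where "\<delta> > 0" and \<delta>: "\<And>w v x. w \<in> unit_profiles \<Longrightarrow> v \<in> unit_profiles \<Longrightarrow> w h = 1 \<Longrightarrow> v h = 1 \<Longrightarrow>
      (\<And>y. y \<in> {0..L} \<Longrightarrow> \<bar>w y - v y\<bar> < \<delta>) \<Longrightarrow> x \<in> {0..L} \<Longrightarrow>
      \<bar>normalized_op p w x - normalized_op p v x\<bar> \<le> \<epsilon>"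
      using normalized_op_stable[OF \<open>p > 0\<close> \<open>\<epsilon> > 0\<close> h(1)] by blast
    have "\<bar>F u i - F v i\<bar> \<le> \<epsilon>"
      if "\<forall>i<n. u i \<in> {0..1}" "\<forall>i<n. v i \<in> {0..1}" "\<forall>i<n. \<bar>u i - v i\<bar> \<le> \<delta> / 2" "i < n" for u v :: "nat \<Rightarrow> real" and i
      unfolding F_def
    proof (rule \<delta>[OF step_profile_unit step_profile_unit h1 h1 _ node])
      show "\<bar>?w u y - ?w v y\<bar> < \<delta>" for y
        using step_profile_diff[OF that(3), of y] \<open>\<delta> > 0\<close> by simp
    qed (use that in auto)
    then show "\<exists>d>0. \<forall>u\<in>{u. \<forall>i<n. u i \<in> {0..1}}. \<forall>v\<in>{u. \<forall>i<n. u i \<in> {0..1}}.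
        (\<forall>i<n. \<bar>u i - v i\<bar> \<le> d) \<longrightarrow> (\<forall>i<n. \<bar>F u i - F v i\<bar> \<le> \<epsilon>)"
      using \<open>\<delta> > 0\<close> by (intro exI[of _ "\<delta> / 2"]) auto
  qed (use \<open>e / 2 > 0\<close> in auto)
  have wu: "?w u \<in> unit_profiles" using u by (rule step_profile_unit)
  obtain c where "c > 0" and c: "\<And>w h. w \<in> unit_profiles \<Longrightarrow> h \<in> {0..L} \<Longrightarrow> c * (h * w h powr p) \<le> power_op p w 0"
    using power_op_zero_pos[OF \<open>p \<ge> 0\<close>] by blast
  have pos: "power_op p (?w u) 0 > 0"
  proof -
    have "0 < c * (h * ?w u h powr p)" using \<open>c > 0\<close> h(1) h1 by simp
    also have "\<dots> \<le> power_op p (?w u) 0" using h(1) by (intro c wu) auto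
    finally show ?thesis .
  qed
  have "\<bar>normalized_op p (?w u) x - ?w u x\<bar> \<le> e" if x: "x \<in> {0..L}" for x
  proof -
    let ?R = "normalized_op p (?w u)"
    \<comment> \<open>The minimum is attained at a node to the left of \<open>x\<close>, where the
      nonincreasing image is at least as large as at \<open>x\<close>.\<close>
    have "?R x - e \<le> ?w u x"
    proof (cases rule: step_profile_cases[of n u x])
      case 1
      then show ?thesis using normalized_op_range[OF wu \<open>p \<ge> 0\<close> x] \<open>e > 0\<close> by simp
    next
      case (2 i)
      then have "?R x \<le> ?R (node i)"
        using node[of i] by (intro normalized_op_antimono wu \<open>p \<ge> 0\<close>) (auto simp: node_def)
      moreover have "\<bar>?R (node i) - u i\<bar> \<le> e / 2" using fix_u[of i] 2 by (simp add: F_def)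
      ultimately show ?thesis using 2(3) \<open>e > 0\<close> by linarith
    qed
    moreover have "?w u x \<le> ?R x + e"
    proof -
      \<comment> \<open>The cap \<open>n - 1\<close> matters for \<open>x = L\<close>, where the
        floor is \<open>n\<close>; the last cell is closed on the right.\<close>
      define k where "k = min (n - 1) (nat \<lfloor>x * real n / L\<rfloor>)"
      have "k < n" using \<open>real n > 0\<close> by (simp add: k_def)
      have "real k \<le> x * real n / L" "x * real n / L \<le> real k + 1"
      proof -
        have "x * real n \<le> L * real n" using x by (intro mult_right_mono) auto
        then have nn: "x * real n / L \<ge> 0" "x * real n / L \<le> real n"
          using x L_pos by (auto simp: divide_le_eq mult.commute)
        then have fl: "real (nat \<lfloor>x * real n / L\<rfloor>) \<le> x * real n / L"
          "x * real n / L \<le> real (nat \<lfloor>x * real n / L\<rfloor>) + 1" by linarith+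
        then show "real k \<le> x * real n / L" by (simp add: k_def)
        show "x * real n / L \<le> real k + 1"
          using fl nn \<open>real n > 0\<close> by (auto simp: k_def min_def of_nat_diff)
      qed
      then have k: "node k \<le> x" "x \<le> node k + L / real n"
        using L_pos \<open>real n > 0\<close> by (auto simp: node_def field_simps)
      then have "\<bar>?R (node k) - ?R x\<bar> \<le> e / 2"
        using mesh by (intro d wu node \<open>k < n\<close> x) auto
      moreover have "?w u x \<le> ?R (node k) + e / 2"
      proof (cases "k = 0")
        case True
        \<comment> \<open>Coordinate 0 does not enter the step profile. Normalization gives exactly
          1 here, as \<open>pos\<close> excludes a zero denominator.\<close>
        have "?R (node k) = 1" using True pos by (simp add: normalized_op_def node_def)
        then show ?thesis using step_profile_le(1)[of n u x] \<open>e > 0\<close> by simp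
      next
        case False
        then have "?w u x \<le> u k" using step_profile_le(2)[of k n x u] k \<open>k < n\<close> by (simp add: node_def)
        moreover have "\<bar>?R (node k) - u k\<bar> \<le> e / 2" using fix_u[OF \<open>k < n\<close>] by (simp add: F_def)
        ultimately show ?thesis by linarith
      qed
      ultimately show ?thesis by linarith
    qed
    ultimately show ?thesis by linarith
  qed
  then show thesis using that wu pos by blast
qed

section \<open>Passage to the limit\<close>

text \<open>The approximate fixed points \<open>v n\<close> may be discontinuous, so Arzela-Ascoli
  is applied to their normalized images. The vanishing error transfers uniform convergence back to
  \<open>v (k n)\<close>, and \<nu> is the value of the limiting numerator at 0.\<close>

lemma fixed_profile_exists:
  assumes "p > 0"
  obtains w \<nu> where "\<nu> > 0" "w \<in> unit_profiles" "continuous_on {0..L} w" "w 0 = 1" "w L = 0"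
    "\<And>x. x \<in> {0..L} \<Longrightarrow> \<nu> * w x = power_op p w x"
proof -
  have "p \<ge> 0" using assms by simp
  have "\<exists>w. w \<in> unit_profiles \<and> power_op p w 0 > 0 \<and>
      (\<forall>x\<in>{0..L}. \<bar>normalized_op p w x - w x\<bar> \<le> inverse (real (Suc n)))" for n
    using approximate_fixed_profile[OF \<open>p > 0\<close>, of "inverse (real (Suc n))"]
    by (metis inverse_positive_iff_positive of_nat_0_less_iff zero_less_Suc)
  then obtain v where v: "\<And>n. v n \<in> unit_profiles" "\<And>n. power_op p (v n) 0 > 0"
    "\<And>n x. x \<in> {0..L} \<Longrightarrow> \<bar>normalized_op p (v n) x - v n x\<bar> \<le> inverse (real (Suc n))"
    by metis
  obtain w k where w_cont: "continuous_on {0..L} w" and k: "strict_mono (k :: nat \<Rightarrow> nat)"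
    and lim: "\<And>e. 0 < e \<Longrightarrow> \<exists>N. \<forall>n x. n \<ge> N \<and> x \<in> {0..L} \<longrightarrow> norm (normalized_op p (v (k n)) x - w x) < e"
  proof (rule Arzela_Ascoli[of "{0..L}" "\<lambda>n. normalized_op p (v n)" 1])
    show "norm (normalized_op p (v n) x) \<le> 1" if "x \<in> {0..L}" for n x
      using normalized_op_range[OF v(1) \<open>p \<ge> 0\<close> that, of n] by simp
    fix x e :: real assume x: "x \<in> {0..L}" and "0 < e"
    then obtain d where "d > 0" and d: "\<And>w x x'. w \<in> unit_profiles \<Longrightarrow> x \<in> {0..L} \<Longrightarrow> x' \<in> {0..L} \<Longrightarrow>
      \<bar>x - x'\<bar> < d \<Longrightarrow> \<bar>normalized_op p w x - normalized_op p w x'\<bar> \<le> e / 2"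
      using normalized_op_equicontinuous[OF \<open>p \<ge> 0\<close>, of "e / 2"] by (metis half_gt_zero)
    show "\<exists>d>0. \<forall>n y. y \<in> {0..L} \<and> norm (x - y) < d \<longrightarrow>
        norm (normalized_op p (v n) x - normalized_op p (v n) y) < e"
    proof (intro exI[of _ d] conjI allI impI \<open>d > 0\<close>)
      fix n y assume "y \<in> {0..L} \<and> norm (x - y) < d"
      then have "\<bar>normalized_op p (v n) x - normalized_op p (v n) y\<bar> \<le> e / 2" using d[OF v(1) x] by simp
      then show "norm (normalized_op p (v n) x - normalized_op p (v n) y) < e" using \<open>0 < e\<close> by simp
    qed
  qed auto
  have R_lim: "(\<lambda>n. normalized_op p (v (k n)) x) \<longlonglongrightarrow> w x" if "x \<in> {0..L}" for x
    unfolding LIMSEQ_iff using lim that by blast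
  have v_unif: "\<exists>N. \<forall>n\<ge>N. \<forall>x\<in>{0..L}. \<bar>v (k n) x - w x\<bar> < e" if e: "e > 0" for e
  proof -
    obtain N1 where N1: "\<And>n x. n \<ge> N1 \<Longrightarrow> x \<in> {0..L} \<Longrightarrow> \<bar>normalized_op p (v (k n)) x - w x\<bar> < e / 2"
      using lim[OF half_gt_zero[OF e]] unfolding real_norm_def by blast
    obtain N2 where N2: "inverse (real (Suc N2)) < e / 2"
      using reals_Archimedean[OF half_gt_zero[OF e]] by blast
    have "\<bar>v (k n) x - w x\<bar> < e" if n: "n \<ge> max N1 N2" and x: "x \<in> {0..L}" for n x
    proof -
      have "N2 \<le> k n" using n seq_suble[OF k, of n] by simp
      then have "inverse (real (Suc (k n))) \<le> inverse (real (Suc N2))" by (intro le_imp_inverse_le) auto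
      moreover have "\<bar>normalized_op p (v (k n)) x - w x\<bar> < e / 2" using N1[OF _ x, of n] n by simp
      ultimately show ?thesis using v(3)[OF x, of "k n"] N2 by linarith
    qed
    then show ?thesis by blast
  qed
  have w_unit: "w \<in> unit_profiles"
  proof -
    have "w y \<le> w x" if "x \<in> {0..L}" "y \<in> {0..L}" "x \<le> y" for x y
      using that by (intro LIMSEQ_le[OF R_lim R_lim] exI allI impI normalized_op_antimono v(1) \<open>p \<ge> 0\<close>) auto
    moreover have "w x \<in> {0..1}" if "x \<in> {0..L}" for x
      using closed_sequentially[OF closed_atLeastAtMost _ R_lim[OF that]]
        normalized_op_range[OF v(1) \<open>p \<ge> 0\<close> that] by blast
    ultimately show ?thesis by (auto simp: unit_profiles_def monotone_on_def)
  qed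
  have w0: "w 0 = 1"
  proof -
    have "normalized_op p (v n) 0 = 1" for n using v(2)[of n] by (simp add: normalized_op_def)
    then show ?thesis using R_lim[of 0] L_pos by (simp add: LIMSEQ_const_iff)
  qed
  have wL: "w L = 0"
  proof -
    have "normalized_op p (v n) L = 0" for n by (simp add: normalized_op_def power_op_def kernel_op_right)
    then show ?thesis using R_lim[of L] L_pos by (simp add: LIMSEQ_const_iff)
  qed
  have N_lim: "(\<lambda>n. power_op p (v (k n)) x) \<longlonglongrightarrow> power_op p w x" for x
  proof (rule LIMSEQ_I)
    fix e :: real assume "e > 0"
    then obtain d where "d > 0" and d: "\<And>w v x. w \<in> unit_profiles \<Longrightarrow> v \<in> unit_profiles \<Longrightarrow>
      (\<And>y. y \<in> {0..L} \<Longrightarrow> \<bar>w y - v y\<bar> < d) \<Longrightarrow> \<bar>power_op p w x - power_op p v x\<bar> \<le> e / 2"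
      using power_op_stable[OF \<open>p > 0\<close>, of "e / 2"] by (metis half_gt_zero)
    obtain N where N: "\<And>n x. n \<ge> N \<Longrightarrow> x \<in> {0..L} \<Longrightarrow> \<bar>v (k n) x - w x\<bar> < d"
      using v_unif[OF \<open>d > 0\<close>] by blast
    show "\<exists>N. \<forall>n\<ge>N. norm (power_op p (v (k n)) x - power_op p w x) < e"
    proof (intro exI[of _ N] allI impI)
      fix n assume "n \<ge> N"
      have "\<bar>power_op p (v (k n)) x - power_op p w x\<bar> \<le> e / 2"
        using d[OF v(1) w_unit N[OF \<open>n \<ge> N\<close>]] .
      then show "norm (power_op p (v (k n)) x - power_op p w x) < e" using \<open>e > 0\<close> by simp
    qed
  qed
  \<comment> \<open>Multiplying by the denominator first avoids dividing by a limit not yet known to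
    be positive.\<close>
  have eq: "power_op p w 0 * w x = power_op p w x" if x: "x \<in> {0..L}" for x
  proof (rule LIMSEQ_unique[OF _ N_lim])
    have "power_op p (v (k n)) 0 * normalized_op p (v (k n)) x = power_op p (v (k n)) x" for n
      using v(2)[of "k n"] by (simp add: normalized_op_def)
    then show "(\<lambda>n. power_op p (v (k n)) x) \<longlonglongrightarrow> power_op p w 0 * w x"
      using tendsto_mult[OF N_lim[of 0] R_lim[OF x]] by simp
  qed
  \<comment> \<open>Positivity of the denominators could be lost in the limit. It is recovered from
    \<open>w 0 = 1\<close>, which by continuity gives a positive value at some
    \<open>h > 0\<close>.\<close>
  obtain c where "c > 0" and c: "\<And>w h. w \<in> unit_profiles \<Longrightarrow> h \<in> {0..L} \<Longrightarrow> c * (h * w h powr p) \<le> power_op p w 0"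
    using power_op_zero_pos[OF \<open>p \<ge> 0\<close>] by blast
  obtain h where h: "h \<in> {0<..L}" "w h > 0"
  proof -
    have "0 \<in> {0..L}" using L_pos by simp
    then obtain d where "d > 0" and d: "\<And>x. x \<in> {0..L} \<Longrightarrow> dist x 0 < d \<Longrightarrow> dist (w x) (w 0) < 1"
      using w_cont[unfolded continuous_on_iff, rule_format, of 0 1] by auto
    have "dist (w (min L (d / 2))) (w 0) < 1" using \<open>d > 0\<close> L_pos by (intro d) (auto simp: dist_real_def)
    then show thesis using that[of "min L (d / 2)"] w0 \<open>d > 0\<close> L_pos by (auto simp: dist_real_def)
  qed
  have "0 < c * (h * w h powr p)" using \<open>c > 0\<close> h by simp
  also have "\<dots> \<le> power_op p w 0" using h(1) by (intro c w_unit) auto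
  finally have "power_op p w 0 > 0" .
  then show thesis using that w_unit w_cont w0 wL eq by blast
qed

end

section \<open>Admissible kernels and the existence theorem\<close>

lemma admissible_kernel_decreasing:
  assumes "admissible_kernel G" "L > 0"
  obtains B where "decreasing_kernel G L B"
proof -
  obtain g where g: "\<And>x. G x = g \<bar>x\<bar>" and g': "\<And>r. r > 0 \<Longrightarrow> \<exists>d<0. (g has_real_derivative d) (at r)"
    and cont: "continuous_on UNIV G" and "bounded (range G)"
    using assms(1) unfolding admissible_kernel_def by auto
  from \<open>bounded (range G)\<close> obtain B where B: "\<And>x. \<bar>G x\<bar> \<le> B" unfolding bounded_iff by auto
  have "G s < G r" if "0 \<le> r" "r < s" for r s
  proof -
    \<comment> \<open>The derivative of \<open>g\<close> is given only for positive arguments;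
      continuity of \<open>G\<close> at the origin extends the strict decrease to
      \<open>r = 0\<close>.\<close>
    have "continuous_on {r..s} g"
      by (rule continuous_on_eq[OF continuous_on_subset[OF cont]]) (use that g in auto)
    then have "g s < g r"
      using g' that by (intro DERIV_neg_imp_decreasing_open[OF \<open>r < s\<close>]) (auto, meson dual_order.strict_trans2)
    then show ?thesis using that by (simp add: g)
  qed
  then have "decreasing_kernel G L B"
    using assms(2) cont B by unfold_locales (auto simp: g)
  then show thesis using that by blast
qed

theorem theorem3p9:
  fixes m :: real and G :: "real \<Rightarrow> real"
  assumes "1 < m" and "m < 2"
    and "admissible_kernel G"
  shows "\<forall>L>0. \<exists>\<nu>>0. \<exists>\<rho>\<in>profiles L. \<forall>x\<in>{0..L}.
           \<nu> * \<rho> x powr (m - 1) = kernel_op G L \<rho> x"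
proof (intro allI impI)
  fix L :: real assume "L > 0"
  then obtain B where "decreasing_kernel G L B"
    using admissible_kernel_decreasing assms(3) by blast
  then interpret decreasing_kernel G L B .
  define p where "p = 1 / (m - 1)"
  have "p > 0" using assms(1) by (simp add: p_def)
  then obtain w \<nu> where "\<nu> > 0" and w: "w \<in> unit_profiles" "continuous_on {0..L} w" "w 0 = 1" "w L = 0"
    and eq: "\<And>x. x \<in> {0..L} \<Longrightarrow> \<nu> * w x = power_op p w x"
    by (rule fixed_profile_exists) blast
  let ?\<rho> = "\<lambda>x. w x powr p"
  have "continuous_on {0..L} ?\<rho>"
    using w(2) \<open>p > 0\<close> unit_profilesD(2)[OF w(1)] by (intro continuous_on_powr') auto
  then have "?\<rho> \<in> profiles L"
    using w powr_antimono_on[OF w(1)] \<open>p > 0\<close> by (simp add: profiles_def)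
  moreover have "\<nu> * ?\<rho> x powr (m - 1) = kernel_op G L ?\<rho> x" if x: "x \<in> {0..L}" for x
  proof -
    \<comment> \<open>The exponents multiply to 1, and \<open>w x powr 1\<close> is
      \<open>w x\<close> since \<open>w x \<ge> 0\<close>.\<close>
    have "?\<rho> x powr (m - 1) = w x"
      using unit_profilesD(2)[OF w(1) x] assms(1) by (simp add: powr_powr p_def)
    then show ?thesis using eq[OF x] by (simp add: power_op_def)
  qed
  ultimately show "\<exists>\<nu>>0. \<exists>\<rho>\<in>profiles L. \<forall>x\<in>{0..L}. \<nu> * \<rho> x powr (m - 1) = kernel_op G L \<rho> x"
    by (intro exI[of _ \<nu>] bexI[of _ ?\<rho>] conjI ballI \<open>\<nu> > 0\<close>)
qed

end
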